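(* We have $E_{Q_5,\mathbf 1}=9$.
   Context: $\mathbb Z_5=\mathbb Z/5\mathbb Z$ and $Q_5=\{1,-1\}$ is the set of non-zero squares in $\mathbb Z_5$. A sequence of length $k$ in $\mathbb Z_5$ is an element of $\mathbb Z_5^k$. A sequence $(x_1,\ldots,x_k)$ in $\mathbb Z_5$ is called a $(Q_5,\mathbf 1)$-weighted zero-sum sequence if there exist $a_1,\ldots,a_k\in Q_5$ such that $a_1x_1+\cdots+a_kx_k=0$ and $a_1+\cdots+a_k=0$ in $\mathbb Z_5$. The constant $E_{Q_5,\mathbf 1}$ is the least positive integer $k$ such that every sequence in $\mathbb Z_5$ of length $k$ has a $(Q_5,\mathbf 1)$-weighted zero-sum subsequence of length $5$ (terms not necessarily consecutive). *)

theory Defs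
  imports "HOL-Library.Numeral_Type" "HOL-Library.Sublist"
begin

text \<open>The numeral type \<open>5\<close> is the ring of integers modulo 5: it has five elements, and
  its ring operations are computed modulo 5.\<close>

type_synonym Z5 = 5

definition Q5 :: "Z5 set" where
  "Q5 = {1, -1}"

lemma Z5_cases: "x \<in> {0, 1, 2, 3, 4}" for x :: Z5
proof (cases x rule: bit1_cases)
  case (of_int z)
  then have "z \<in> {0, 1, 2, 3, 4}" by auto
  then show ?thesis using of_int by auto
qed

lemma Q5_eq_nonzero_squares: "Q5 = {y. y \<noteq> 0 \<and> (\<exists>x. y = x\<^sup>2)}"
proof (intro set_eqI iffI)
  fix y :: Z5
  assume "y \<in> Q5"
  then have "y \<noteq> 0 \<and> (y = 1\<^sup>2 \<or> y = 2\<^sup>2)" by (auto simp: Q5_def)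
  then show "y \<in> {y. y \<noteq> 0 \<and> (\<exists>x. y = x\<^sup>2)}" by blast
next
  fix y :: Z5
  assume "y \<in> {y. y \<noteq> 0 \<and> (\<exists>x. y = x\<^sup>2)}"
  then obtain x where "y \<noteq> 0" "y = x\<^sup>2" by blast
  then show "y \<in> Q5" using Z5_cases[of x] by (auto simp: Q5_def)
qed

text \<open>Sequences of length \<open>k\<close> are lists of length \<open>k\<close>. The weights \<open>as\<close> give one element
  of \<open>A\<close> for each position of the sequence.\<close>

definition weighted_zero_sum :: "Z5 set \<Rightarrow> Z5 list \<Rightarrow> bool" where
  "weighted_zero_sum A xs \<longleftrightarrow>
     (\<exists>as. length as = length xs \<and> set as \<subseteq> A \<and>
           (\<Sum>i<length xs. as ! i * xs ! i) = 0 \<and>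
           (\<Sum>i<length xs. as ! i) = 0)"

text \<open>\<open>subseq\<close> is the subsequence relation whose terms need not be consecutive.\<close>

definition E_const :: "Z5 set \<Rightarrow> nat" where
  "E_const A = (LEAST k. 0 < k \<and>
     (\<forall>xs :: Z5 list. length xs = k \<longrightarrow>
        (\<exists>ys. subseq ys xs \<and> length ys = 5 \<and> weighted_zero_sum A ys)))"

end

theory Submission imports Defs begin

text \<open>
  Five signs sum to zero modulo 5 only if they all agree, so a weighted zero-sum sequence of
  length 5 is just a sequence with sum zero and the claim is the Erdos--Ginzburg--Ziv theorem for
  the prime 5. The sequence consisting of four zeros and four ones gives the lower bound. For the
  upper bound, sort nine terms as \<open>y\<^sub>0 \<le> \<dots> \<le> y\<^sub>8\<close>. If \<open>y\<^sub>i = y\<^bsub>i+4\<^esub>\<close> for some \<open>i\<close>, then five terms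
  coincide; otherwise \<open>y\<^sub>0 + {y\<^sub>1, y\<^sub>5} + \<dots> + {y\<^sub>4, y\<^sub>8}\<close> is all of \<open>\<int>\<^sub>5\<close>, since each
  two-element summand enlarges a proper nonempty subset.
\<close>

text \<open>A sum of five signs is an odd integer between -5 and 5, so it is 0 modulo 5 only at the
  two ends. The common sign then cancels from the weighted sum.\<close>

lemma weighted_zero_sum_Q5_iff:
  assumes "length ys = 5"
  shows "weighted_zero_sum Q5 ys \<longleftrightarrow> sum_list ys = 0"
proof
  assume "weighted_zero_sum Q5 ys"
  then obtain ws where ws: "length ws = 5" "set ws \<subseteq> Q5"
      "(\<Sum>i<5. ws ! i * ys ! i) = 0" "(\<Sum>i<5. ws ! i) = 0"
    using assms by (auto simp: weighted_zero_sum_def)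
  obtain a b c d e where abcde: "ws = [a, b, c, d, e]"
    using ws(1) by (auto simp: eval_nat_numeral length_Suc_conv)
  have "a + b + c + d + e = 0"
    using ws(4) by (simp add: abcde eval_nat_numeral)
  moreover have "a = 1 \<or> a = -1" "b = 1 \<or> b = -1" "c = 1 \<or> c = -1"
      "d = 1 \<or> d = -1" "e = 1 \<or> e = -1"
    using ws(2) by (auto simp: abcde Q5_def)
  ultimately have "b = a \<and> c = a \<and> d = a \<and> e = a"
    by (elim disjE) simp_all
  then have "ws = replicate 5 a"
    by (simp add: abcde eval_nat_numeral)
  then have "a * (\<Sum>i<5. ys ! i) = 0"
    using ws(3) by (simp add: sum_distrib_left)
  with \<open>a = 1 \<or> a = -1\<close> show "sum_list ys = 0"
    using assms by (auto simp: sum_list_sum_nth atLeast0LessThan)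
next
  assume "sum_list ys = 0"
  then show "weighted_zero_sum Q5 ys"
    unfolding weighted_zero_sum_def using assms
    by (intro exI[of _ "replicate 5 1"])
      (auto simp: Q5_def sum_list_sum_nth atLeast0LessThan)
qed

lemma subseq_replicateD:
  assumes "subseq ys (replicate n x)"
  shows "\<exists>m\<le>n. ys = replicate m x"
proof -
  have "set ys \<subseteq> {x}"
    using assms by (auto elim!: list_emb_set)
  then have "ys = replicate (length ys) x"
    by (intro replicate_eqI) auto
  moreover have "length ys \<le> n"
    using list_emb_length[OF assms] by simp
  ultimately show ?thesis by blast
qed

text \<open>Five terms out of at most four zeros and at most four ones include between one and four
  ones. Leaving \<open>m\<close> and \<open>n\<close> free covers every length below 9 at
  once.\<close>

lemma no_weighted_zero_sum_replicate:
  assumes "m \<le> 4" "n \<le> 4" "subseq ys (replicate m 0 @ replicate n 1)" "length ys = 5"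
  shows "\<not> weighted_zero_sum Q5 ys"
proof -
  obtain us vs where "ys = us @ vs" "subseq us (replicate m 0)" "subseq vs (replicate n 1)"
    using assms(3) by (auto elim!: subseq_appendE)
  then obtain k l where kl: "k \<le> m" "l \<le> n" "ys = replicate k 0 @ replicate l 1"
    by (blast dest: subseq_replicateD)
  then have "l \<in> {1, 2, 3, 4}" using assms by auto
  then have "sum_list ys \<noteq> 0"
    by (auto simp: kl(3) sum_list_replicate)
  with assms(4) show ?thesis by (simp add: weighted_zero_sum_Q5_iff)
qed

text \<open>Since 5 is prime, the multiples of \<open>d\<close> run through all of
  \<open>Z5\<close>.\<close>

lemma Z5_closed_under_add_eq_UNIV:
  fixes d :: Z5
  assumes "a \<in> A" "d \<noteq> 0" and closed: "\<And>x. x \<in> A \<Longrightarrow> x + d \<in> A"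
  shows "A = UNIV"
proof -
  have mult: "a + of_nat k * d \<in> A" for k
  proof (induction k)
    case (Suc k)
    then show ?case using closed[of "a + of_nat k * d"] by (simp add: algebra_simps)
  qed (use assms(1) in simp)
  have "z \<in> A" for z
  proof -
    have "\<exists>k\<in>{0, 1, 2, 3, 4::nat}. of_nat k * d = z - a"
      using assms(2) Z5_cases[of d] Z5_cases[of "z - a"] by (elim insertE) auto
    then obtain k where "of_nat k * d = z - a" by blast
    with mult[of k] show ?thesis by simp
  qed
  then show ?thesis by blast
qed

text \<open>Cauchy-Davenport for a two-element summand: without growth the two translates coincide,
  so \<open>A\<close> is invariant under the nonzero shift \<open>b - c\<close>.\<close>

lemma card_sumset_pair:
  fixes b c :: Z5
  assumes "A \<noteq> {}" "b \<noteq> c"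
  shows "min 5 (card A + 1) \<le> card ((\<lambda>x. x + b) ` A \<union> (\<lambda>x. x + c) ` A)"
    (is "_ \<le> card (?B \<union> ?C)")
proof (rule ccontr)
  assume less: "\<not> ?thesis"
  have card: "card ?B = card A" "card ?C = card A"
    by (auto intro!: card_image inj_onI)
  have "?B = ?B \<union> ?C" "?C = ?B \<union> ?C"
    by (rule card_seteq; use less card in auto)+
  then have "?B = ?C" by blast
  have "x + (b - c) \<in> A" if "x \<in> A" for x
  proof -
    have "x + b \<in> ?C" using that \<open>?B = ?C\<close> by blast
    then obtain y where "y \<in> A" "x + b = y + c" by blast
    then have "y = x + (b - c)" by (simp add: algebra_simps)
    with \<open>y \<in> A\<close> show ?thesis by simp
  qed
  then have "A = UNIV"
    using assms Z5_closed_under_add_eq_UNIV[of _ A "b - c"] by auto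
  with less card card_mono[of "?B \<union> ?C" ?B] show False by simp
qed

text \<open>Iterates the pair bound. Choices are functions \<open>h\<close> into indices rather than
  values, so that a sum can be traced back to the terms it uses.\<close>

lemma card_choice_sums:
  fixes y :: "nat \<Rightarrow> Z5"
  assumes "\<And>i. i < n \<Longrightarrow> y (p i) \<noteq> y (q i)"
  shows "min 5 (n + 1) \<le> card ((\<lambda>h. \<Sum>i<n. y (h i)) ` {h. \<forall>i<n. h i = p i \<or> h i = q i})"
    (is "_ \<le> card (?S n)")
  using assms
proof (induction n)
  case 0
  have "?S 0 = {0}" by auto
  then show ?case by simp
next
  case (Suc n)
  let ?T = "(\<lambda>x. x + y (p n)) ` ?S n \<union> (\<lambda>x. x + y (q n)) ` ?S n"
  have IH: "min 5 (n + 1) \<le> card (?S n)" using Suc by simp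
  have "?S n \<noteq> {}" by auto
  \<comment> \<open>\<open>h\<close> is unconstrained from \<open>n\<close> on, so resetting it at
    \<open>n\<close> leaves the first \<open>n\<close> summands alone.\<close>
  have "(\<Sum>i<n. y (h i)) + y r \<in> ?S (Suc n)"
    if "\<forall>i<n. h i = p i \<or> h i = q i" "r = p n \<or> r = q n" for h r
    using that by (intro image_eqI[where x = "h(n := r)"]) (auto simp: less_Suc_eq)
  then have "?T \<subseteq> ?S (Suc n)" by blast
  then have "card ?T \<le> card (?S (Suc n))"
    by (intro card_mono) auto
  moreover have "min 5 (card (?S n) + 1) \<le> card ?T"
    using \<open>?S n \<noteq> {}\<close> Suc.prems by (intro card_sumset_pair) auto
  ultimately show ?case using IH by simp
qed

text \<open>The order on \<open>Z5\<close> does not respect addition; it serves only to make equal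
  values adjacent.\<close>

lemma exists_zero_sum_indices:
  fixes y :: "nat \<Rightarrow> Z5"
  assumes mono: "\<And>i j. i \<le> j \<Longrightarrow> j < 9 \<Longrightarrow> y i \<le> y j"
  shows "\<exists>S\<subseteq>{..<9}. card S = 5 \<and> sum y S = 0"
proof (cases "\<exists>i<5. y i = y (i + 4)")
  case True
  then obtain i where i: "i < 5" "y i = y (i + 4)" by blast
  have "y j = y i" if "j \<in> {i..i+4}" for j
    using mono[of i j] mono[of j "i + 4"] that i by auto
  then have "sum y {i..i+4} = (\<Sum>j\<in>{i..i+4}. y i)"
    by (rule sum.cong[OF refl])
  then have "sum y {i..i+4} = 0"
    using Z5_cases[of "y i"] by auto
  then show ?thesis
    using i(1) by (intro exI[of _ "{i..i+4}"]) auto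
next
  case False
  let ?H = "{h. \<forall>i<4. h i = i + 1 \<or> h i = i + 5}"
  let ?s = "\<lambda>h. \<Sum>i<4. y (h i)"
  have "y i \<noteq> y (i + 4)" if "i < 5" for i
    using False that by blast
  from this[of "i + 1" for i] have "y (i + 1) \<noteq> y (i + 5)" if "i < 4" for i
    using that by (simp add: add.commute)
  then have "5 \<le> card (?s ` ?H)"
    using card_choice_sums[of 4 y "\<lambda>i. i + 1" "\<lambda>i. i + 5"] by simp
  then have "?s ` ?H = UNIV"
    by (intro card_seteq) auto
  \<comment> \<open>Index 0 lies in no pair, so it supplies the fifth term and fixes the
    target.\<close>
  then have "- y 0 \<in> ?s ` ?H" by (simp only: UNIV_I)
  then obtain h where "h \<in> ?H" and sum: "?s h = - y 0"
    by (elim imageE) simp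
  then have h: "h i = i + 1 \<or> h i = i + 5" if "i < 4" for i
    using that by blast
  \<comment> \<open>The options \<open>i + 1\<close> lie in 1..4 and the options
    \<open>i + 5\<close> in 5..8, so different pairs share no index.\<close>
  have inj: "inj_on h {..<4}"
  proof (rule inj_onI)
    fix i j assume "i \<in> {..<4}" "j \<in> {..<4}" "h i = h j"
    then show "i = j" using h[of i] h[of j] by auto
  qed
  have notin: "0 \<notin> h ` {..<4}"
    using h by force
  show ?thesis
  proof (intro exI conjI)
    show "insert 0 (h ` {..<4}) \<subseteq> {..<9}" using h by force
    show "card (insert 0 (h ` {..<4})) = 5" using notin inj by (simp add: card_image)
    show "sum y (insert 0 (h ` {..<4})) = 0" using notin inj sum by (simp add: sum.reindex)
  qed
qed

lemma exists_zero_sum_subseq: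
  fixes xs :: "Z5 list"
  assumes "length xs = 9"
  shows "\<exists>ys. subseq ys xs \<and> length ys = 5 \<and> sum_list ys = 0"
proof -
  \<comment> \<open>Positions are sorted instead of values, so the chosen indices pull back to a
    position set \<open>T\<close>, and \<open>nths\<close> restores the original order.\<close>
  define js where "js = sort_key ((!) xs) [0..<9]"
  have js: "length js = 9" "distinct js" "set js = {..<9}" "sorted (map ((!) xs) js)"
    by (auto simp: js_def)
  have "xs ! (js ! i) \<le> xs ! (js ! j)" if "i \<le> j" "j < 9" for i j
    using sorted_nth_mono[OF js(4) that(1)] that js(1) by simp
  from exists_zero_sum_indices[of "\<lambda>i. xs ! (js ! i)", OF this]
  obtain S where S: "S \<subseteq> {..<9}" "card S = 5" "(\<Sum>i\<in>S. xs ! (js ! i)) = 0"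
    by blast
  have inj: "inj_on ((!) js) S"
    using S(1) js(1,2) by (intro inj_on_nth) auto
  define T where "T = (!) js ` S"
  have T: "T \<subseteq> {..<9}" "card T = 5" "(\<Sum>i\<in>T. xs ! i) = 0"
    using S js inj nth_mem[of _ js] by (auto simp: T_def card_image sum.reindex)
  have T_eq: "{i. i < length xs \<and> i \<in> T} = T" using T assms by auto
  have "length (nths xs T) = 5"
    using T by (simp add: length_nths T_eq)
  moreover have "sum_list (nths xs T) = 0"
  proof -
    \<comment> \<open>Passing to the list of positions, which is distinct, turns the list sum into a
      sum over \<open>T\<close>.\<close>
    have "nths xs T = map ((!) xs) (nths [0..<length xs] T)"
      by (metis map_nth nths_map)
    moreover have "set (nths [0..<length xs] T) = T"
      using T(1) assms by (force simp: set_nths)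
    ultimately show ?thesis
      using T by (simp add: sum_list_distinct_conv_sum_set)
  qed
  moreover have "subseq (nths xs T) xs"
    unfolding subseq_conv_nths by (rule exI, rule refl)
  ultimately show ?thesis by (intro exI conjI)
qed

theorem corollary2p4: "E_const Q5 = 9"
  unfolding E_const_def
proof (rule Least_equality)
  show "0 < (9::nat) \<and> (\<forall>xs :: Z5 list. length xs = 9 \<longrightarrow>
      (\<exists>ys. subseq ys xs \<and> length ys = 5 \<and> weighted_zero_sum Q5 ys))"
    using exists_zero_sum_subseq weighted_zero_sum_Q5_iff by (metis zero_less_numeral)
next
  fix k :: nat
  assume k: "0 < k \<and> (\<forall>xs :: Z5 list. length xs = k \<longrightarrow>
      (\<exists>ys. subseq ys xs \<and> length ys = 5 \<and> weighted_zero_sum Q5 ys))"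
  show "9 \<le> k"
  proof (rule ccontr)
    assume "\<not> 9 \<le> k"
    \<comment> \<open>Truncated subtraction gives no ones when \<open>k\<close> is at most 4, and
      \<open>k < 9\<close> leaves at most four.\<close>
    moreover have "length (replicate (min k 4) (0::Z5) @ replicate (k - 4) 1) = k" by auto
    ultimately show False
      using k no_weighted_zero_sum_replicate[of "min k 4" "k - 4"] by fastforce
  qed
qed

end
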